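(* Let $(W,R)$ be a quasi-ordered frame and $n\ge1$. 1. The topological space $W_R$ is hereditarily $(n+1)$-irresolvable iff $(W,R)$ has circumference at most $n$ and has no strictly ascending chains. 2. If $W$ is finite, then $W_R$ is hereditarily $(n+1)$-irresolvable iff $(W,R)$ has circumference at most $n$.
   Context: A quasi-order is a reflexive transitive relation. $W_R$ is $W$ with the Alexandroff topology whose open sets are the $R$-up-sets (if $x\in O$ and $xRy$ then $y\in O$). For $k\ge2$, a space is $k$-resolvable if it has $k$ pairwise disjoint dense subsets, $k$-irresolvable otherwise, and hereditarily $k$-irresolvable if every non-empty subspace is $k$-irresolvable. The circumference of a frame is the supremum of lengths $n$ of cycles (sequences of $n$ distinct points $x_0,\dots,x_{n-1}$ with $x_0R\cdots Rx_{n-1}Rx_0$), and 0 if none. A strictly ascending chain is a sequence $(x_m)_{m<\omega}$ with $x_mRx_{m+1}$ and not $x_{m+1}Rx_m$ for all $m$. *)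

theory Defs
  imports "HOL-Analysis.Abstract_Topology" "HOL-Library.Disjoint_Sets" "HOL-Library.Extended_Nat"
begin

definition alexandroff_topology :: "'a set \<Rightarrow> 'a rel \<Rightarrow> 'a topology" where
  "alexandroff_topology W R =
     topology (\<lambda>U. U \<subseteq> W \<and> (\<forall>x\<in>U. \<forall>y\<in>W. (x, y) \<in> R \<longrightarrow> y \<in> U))"

lemma openin_alexandroff_topology:
  "openin (alexandroff_topology W R) U \<longleftrightarrow>
     U \<subseteq> W \<and> (\<forall>x\<in>U. \<forall>y\<in>W. (x, y) \<in> R \<longrightarrow> y \<in> U)"
proof -
  have "istopology (\<lambda>U. U \<subseteq> W \<and> (\<forall>x\<in>U. \<forall>y\<in>W. (x, y) \<in> R \<longrightarrow> y \<in> U))"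
    unfolding istopology_def by blast
  then show ?thesis
    by (simp add: alexandroff_topology_def)
qed

lemma topspace_alexandroff_topology: "topspace (alexandroff_topology W R) = W"
  by (auto simp: topspace_def openin_alexandroff_topology)

definition dense_in :: "'a topology \<Rightarrow> 'a set \<Rightarrow> bool" where
  "dense_in X D \<longleftrightarrow> D \<subseteq> topspace X \<and> X closure_of D = topspace X"

text \<open>Dense subsets of a non-empty space are non-empty, so there the \<open>k\<close> indexed
  sets below are automatically distinct. The empty space is \<open>k\<close>-resolvable for all \<open>k\<close>
  under this definition, but it is excluded in the hereditary notion.\<close>

definition resolvable :: "nat \<Rightarrow> 'a topology \<Rightarrow> bool" where
  "resolvable k X \<longleftrightarrow>
     (\<exists>D :: nat \<Rightarrow> 'a set. (\<forall>i<k. dense_in X (D i)) \<and> disjoint_family_on D {..<k})"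

definition hereditarily_irresolvable :: "nat \<Rightarrow> 'a topology \<Rightarrow> bool" where
  "hereditarily_irresolvable k X \<longleftrightarrow>
     (\<forall>S. S \<subseteq> topspace X \<and> S \<noteq> {} \<longrightarrow> \<not> resolvable k (subtopology X S))"

definition is_cycle :: "'a set \<Rightarrow> 'a rel \<Rightarrow> 'a list \<Rightarrow> bool" where
  "is_cycle W R xs \<longleftrightarrow> xs \<noteq> [] \<and> set xs \<subseteq> W \<and> distinct xs \<and>
     successively (\<lambda>x y. (x, y) \<in> R) xs \<and> (last xs, hd xs) \<in> R"

text \<open>The supremum is taken in \<^typ>\<open>enat\<close>: it is \<open>0\<close> if there are no cycles and
  \<open>\<infinity>\<close> if cycle lengths are unbounded.\<close>

definition circumference :: "'a set \<Rightarrow> 'a rel \<Rightarrow> enat" where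
  "circumference W R = Sup {enat (length xs) | xs. is_cycle W R xs}"

definition strictly_ascending_chain :: "'a set \<Rightarrow> 'a rel \<Rightarrow> (nat \<Rightarrow> 'a) \<Rightarrow> bool" where
  "strictly_ascending_chain W R x \<longleftrightarrow>
     (\<forall>m. x m \<in> W) \<and> (\<forall>m. (x m, x (Suc m)) \<in> R \<and> (x (Suc m), x m) \<notin> R)"

end

theory Submission
  imports Defs
begin

text \<open>In a subspace \<open>S\<close> of \<open>W\<^sub>R\<close> the smallest neighbourhood of a point \<open>x\<close> is the set of its
  \<open>R\<close>-successors in \<open>S\<close>, so a set is dense iff every point of \<open>S\<close> sees a point of it. A cycle of
  length \<open>k\<close> is a set of \<open>k\<close> points that all see each other, and its singletons are dense; a
  strictly ascending chain splits into \<open>k\<close> cofinal, hence dense, residue classes modulo \<open>k\<close>.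
  Conversely, without strictly ascending chains a non-empty \<open>S\<close> has an \<open>R\<close>-maximal point, and
  the points that it sees in \<open>k\<close> disjoint dense sets form a cycle of length \<open>k\<close>.\<close>

lemma dense_in_subtopology_alexandroff:
  assumes "preorder_on W R" and "S \<subseteq> W"
  shows "dense_in (subtopology (alexandroff_topology W R) S) D \<longleftrightarrow>
    D \<subseteq> S \<and> (\<forall>x\<in>S. \<exists>y\<in>D. (x, y) \<in> R)"
proof -
  let ?X = "subtopology (alexandroff_topology W R) S"
  have refl: "\<And>x. x \<in> W \<Longrightarrow> (x, x) \<in> R" and trans: "trans R"
    using assms(1) by (auto simp: preorder_on_def refl_on_def)
  have top: "topspace ?X = S"
    using assms(2) by (auto simp: topspace_alexandroff_topology)
  have sees: "(\<exists>y\<in>D. (x, y) \<in> R) \<longleftrightarrow> x \<in> ?X closure_of D" if D: "D \<subseteq> S" and x: "x \<in> S" for x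
  proof
    assume "\<exists>y\<in>D. (x, y) \<in> R"
    then show "x \<in> ?X closure_of D"
      using D x assms(2) top
      by (fastforce simp: in_closure_of openin_subtopology openin_alexandroff_topology)
  next
    assume cl: "x \<in> ?X closure_of D"
    \<comment> \<open>Transitivity makes the successor set of \<open>x\<close> open and reflexivity
      puts \<open>x\<close> in it, so a point in the closure of \<open>D\<close> must find a point
      of \<open>D\<close> among its successors.\<close>
    have "openin (alexandroff_topology W R) {y \<in> W. (x, y) \<in> R}"
      using trans by (auto simp: openin_alexandroff_topology dest: transD)
    then have "openin ?X (S \<inter> {y \<in> W. (x, y) \<in> R})"
      by (auto simp: openin_subtopology)
    moreover have "x \<in> S \<inter> {y \<in> W. (x, y) \<in> R}"
      using x assms(2) refl by auto
    ultimately obtain y where "y \<in> D" "y \<in> S \<inter> {y \<in> W. (x, y) \<in> R}"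
      using cl by (metis (no_types, lifting) in_closure_of)
    then show "\<exists>y\<in>D. (x, y) \<in> R"
      by blast
  qed
  have "?X closure_of D \<subseteq> S"
    using closure_of_subset_topspace[of ?X D] top by simp
  then have "?X closure_of D = S \<longleftrightarrow> (\<forall>x\<in>S. x \<in> ?X closure_of D)"
    by blast
  then show ?thesis
    unfolding dense_in_def top by (simp add: sees cong: conj_cong)
qed

text \<open>Under transitivity the order of the points in a cycle is immaterial. This form lets
  cycles be matched with families of mutually related points.\<close>

lemma is_cycle_iff_clique:
  assumes "preorder_on W R"
  shows "is_cycle W R xs \<longleftrightarrow>
    xs \<noteq> [] \<and> set xs \<subseteq> W \<and> distinct xs \<and> set xs \<times> set xs \<subseteq> R"
proof
  assume "is_cycle W R xs"
  then have ne: "xs \<noteq> []" and sub: "set xs \<subseteq> W" and dist: "distinct xs"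
    and succ: "successively (\<lambda>x y. (x, y) \<in> R) xs" and last: "(last xs, hd xs) \<in> R"
    by (auto simp: is_cycle_def)
  have refl: "\<And>x. x \<in> W \<Longrightarrow> (x, x) \<in> R" and trans: "trans R"
    using assms by (auto simp: preorder_on_def refl_on_def)
  \<comment> \<open>Transitivity extends the relation from neighbouring entries to all positions
    \<open>i < j\<close>; equal positions need reflexivity.\<close>
  have "sorted_wrt (\<lambda>x y. (x, y) \<in> R) xs"
    using succ trans by (subst (asm) successively_iff_sorted_wrt_strong) (auto dest: transD)
  then have le: "(xs ! i, xs ! j) \<in> R" if "i \<le> j" "j < length xs" for i j
  proof (cases "i = j")
    case True
    have "xs ! j \<in> W"
      using that sub by (meson nth_mem subsetD)
    then show ?thesis
      using True refl by simp
  next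
    case False
    then show ?thesis
      using that \<open>sorted_wrt _ xs\<close> by (simp add: sorted_wrt_iff_nth_less)
  qed
  \<comment> \<open>Go forward from \<open>a\<close> to the last entry, take the closing edge to the
    head, then go forward to \<open>b\<close>.\<close>
  have "(a, b) \<in> R" if a: "a \<in> set xs" and b: "b \<in> set xs" for a b
  proof -
    have "(a, last xs) \<in> R"
      using a ne le by (auto simp: in_set_conv_nth last_conv_nth)
    moreover have "(hd xs, b) \<in> R"
      using b ne le by (auto simp: in_set_conv_nth hd_conv_nth)
    ultimately show ?thesis
      using last trans by (meson transD)
  qed
  with ne sub dist show
    "xs \<noteq> [] \<and> set xs \<subseteq> W \<and> distinct xs \<and> set xs \<times> set xs \<subseteq> R"
    by auto
next
  assume *: "xs \<noteq> [] \<and> set xs \<subseteq> W \<and> distinct xs \<and> set xs \<times> set xs \<subseteq> R"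
  then have "successively (\<lambda>x y. (x, y) \<in> R) xs"
    by (intro successively_if_sorted_wrt) (auto simp: sorted_wrt_iff_nth_less)
  moreover have "last xs \<in> set xs" "hd xs \<in> set xs"
    using * by simp_all
  ultimately show "is_cycle W R xs"
    using * by (auto simp: is_cycle_def)
qed

lemma circumference_le_iff:
  "circumference W R \<le> enat n \<longleftrightarrow> (\<forall>xs. is_cycle W R xs \<longrightarrow> length xs \<le> n)"
  by (auto simp: circumference_def Sup_le_iff)

lemma strictly_ascending_chain_iff_le:
  assumes "preorder_on W R" and chain: "strictly_ascending_chain W R x"
  shows "(x i, x j) \<in> R \<longleftrightarrow> i \<le> j"
proof -
  have W: "\<And>m. x m \<in> W" and step: "\<And>m. (x m, x (Suc m)) \<in> R"
    and strict: "\<And>m. (x (Suc m), x m) \<notin> R"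
    using chain by (auto simp: strictly_ascending_chain_def)
  have refl: "\<And>x. x \<in> W \<Longrightarrow> (x, x) \<in> R" and trans: "trans R"
    using assms(1) by (auto simp: preorder_on_def refl_on_def)
  have le: "(x i, x j) \<in> R" if "i \<le> j" for i j
    using that
  proof (induction rule: dec_induct)
    case base
    show ?case using refl W by blast
  next
    case (step m)
    then show ?case using \<open>\<And>m. (x m, x (Suc m)) \<in> R\<close> trans by (meson transD)
  qed
  \<comment> \<open>A step back from \<open>x i\<close> to \<open>x j\<close> would give
    \<open>x (Suc j)\<close> R \<open>x i\<close> R \<open>x j\<close>, against strictness at
    \<open>j\<close>.\<close>
  have "(x i, x j) \<notin> R" if "j < i"
  proof
    assume "(x i, x j) \<in> R"
    moreover have "(x (Suc j), x i) \<in> R"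
      using le that by simp
    ultimately show False
      using strict trans by (meson transD)
  qed
  with le show ?thesis
    by (meson not_le)
qed

lemma inj_strictly_ascending_chain:
  assumes "preorder_on W R" and "strictly_ascending_chain W R x"
  shows "inj x"
proof (rule injI)
  fix i j
  assume "x i = x j"
  then show "i = j"
    using strictly_ascending_chain_iff_le[OF assms, of i j]
      strictly_ascending_chain_iff_le[OF assms, of j i]
      strictly_ascending_chain_iff_le[OF assms, of i i] by simp
qed

text \<open>If every point of \<open>S\<close> had a strict successor in \<open>S\<close>, dependent
  choice would build a chain. As \<open>R\<close> need not be antisymmetric, maximal means that
  every point of \<open>S\<close> above \<open>x\<close> also sees \<open>x\<close>.\<close>

lemma ex_maximal_if_no_strictly_ascending_chain:
  assumes "\<nexists>x. strictly_ascending_chain W R x" and "S \<subseteq> W" and "S \<noteq> {}"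
  obtains x where "x \<in> S" and "\<And>y. y \<in> S \<Longrightarrow> (x, y) \<in> R \<Longrightarrow> (y, x) \<in> R"
proof (rule ccontr)
  assume "\<not> thesis"
  with that have ex: "\<exists>y. y \<in> S \<and> (x, y) \<in> R \<and> (y, x) \<notin> R" if "x \<in> S" for x
    using \<open>x \<in> S\<close> by blast
  obtain f where "\<And>m. f m \<in> S" and "\<And>m. (f m, f (Suc m)) \<in> R \<and> (f (Suc m), f m) \<notin> R"
    using dependent_nat_choice[of "\<lambda>_ x. x \<in> S" "\<lambda>_ x y. (x, y) \<in> R \<and> (y, x) \<notin> R"]
      assms(3) ex by blast
  then have "strictly_ascending_chain W R f"
    using assms(2) by (auto simp: strictly_ascending_chain_def)
  with assms(1) show False
    by blast
qed

text \<open>Dense sets need not cover the space, so the first \<open>k\<close> points of a longer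
  cycle suffice.\<close>

lemma resolvable_cycle:
  assumes "preorder_on W R" and "is_cycle W R xs" and "k \<le> length xs"
  shows "resolvable k (subtopology (alexandroff_topology W R) (set xs))"
proof -
  have sub: "set xs \<subseteq> W" and dist: "distinct xs" and clique: "set xs \<times> set xs \<subseteq> R"
    using assms(1,2) by (auto simp: is_cycle_iff_clique)
  have "dense_in (subtopology (alexandroff_topology W R) (set xs)) {xs ! i}" if "i < k" for i
  proof -
    have "xs ! i \<in> set xs"
      using that assms(3) by simp
    then show ?thesis
      using clique by (auto simp: dense_in_subtopology_alexandroff[OF assms(1) sub])
  qed
  moreover have "disjoint_family_on (\<lambda>i. {xs ! i}) {..<k}"
    using dist assms(3) by (auto simp: disjoint_family_on_def nth_eq_iff_index_eq)
  ultimately show ?thesis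
    unfolding resolvable_def by (intro exI[of _ "\<lambda>i. {xs ! i}"]) simp
qed

lemma resolvable_strictly_ascending_chain:
  assumes "preorder_on W R" and chain: "strictly_ascending_chain W R x"
  shows "resolvable k (subtopology (alexandroff_topology W R) (range x))"
proof -
  define D where "D i = x ` {m. m mod k = i}" for i
  have sub: "range x \<subseteq> W"
    using chain by (auto simp: strictly_ascending_chain_def)
  have "\<exists>y\<in>D i. (x m, y) \<in> R" if "i < k" for i m
  proof
    \<comment> \<open>Since \<open>i < k\<close>, this index has residue \<open>i\<close>; since
      then \<open>k > 0\<close>, it is at least \<open>m\<close>.\<close>
    show "x (m * k + i) \<in> D i"
      using that by (auto simp: D_def)
    have "m \<le> m * k + i"
      using that by (cases k) auto
    then show "(x m, x (m * k + i)) \<in> R"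
      using strictly_ascending_chain_iff_le[OF assms] by blast
  qed
  then have "dense_in (subtopology (alexandroff_topology W R) (range x)) (D i)" if "i < k" for i
    using that by (auto simp: dense_in_subtopology_alexandroff[OF assms(1) sub] D_def)
  moreover have "disjoint_family_on D {..<k}"
    using inj_strictly_ascending_chain[OF assms]
    by (auto simp: disjoint_family_on_def D_def dest: injD)
  ultimately show ?thesis
    unfolding resolvable_def by blast
qed

lemma ex_cycle_if_resolvable:
  assumes pre: "preorder_on W R" and no_chain: "\<nexists>x. strictly_ascending_chain W R x"
    and S: "S \<subseteq> W" "S \<noteq> {}" and "k > 0"
    and res: "resolvable k (subtopology (alexandroff_topology W R) S)"
  shows "\<exists>xs. is_cycle W R xs \<and> length xs = k"
proof -
  have trans: "trans R"
    using pre by (simp add: preorder_on_def)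
  obtain x where x: "x \<in> S" and max: "\<And>y. y \<in> S \<Longrightarrow> (x, y) \<in> R \<Longrightarrow> (y, x) \<in> R"
    using ex_maximal_if_no_strictly_ascending_chain[OF no_chain S] by blast
  obtain D where D: "\<And>i. i < k \<Longrightarrow> D i \<subseteq> S \<and> (\<forall>x\<in>S. \<exists>y\<in>D i. (x, y) \<in> R)"
    and disj: "disjoint_family_on D {..<k}"
    using res unfolding resolvable_def dense_in_subtopology_alexandroff[OF pre S(1)] by blast
  have "\<forall>i\<in>{..<k}. \<exists>y. y \<in> D i \<and> (x, y) \<in> R"
    using D x by blast
  then obtain d where d: "\<And>i. i < k \<Longrightarrow> d i \<in> D i \<and> (x, d i) \<in> R"
    by (metis lessThan_iff)
  have dS: "d i \<in> S" if "i < k" for i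
    using D d that by blast
  \<comment> \<open>The path runs through \<open>x\<close>: maximality gives \<open>d i\<close> R
    \<open>x\<close>, and \<open>x\<close> R \<open>d j\<close> holds by choice of
    \<open>d\<close>.\<close>
  have "(d i, d j) \<in> R" if "i < k" "j < k" for i j
    using max[OF dS] d that trans by (meson transD)
  moreover have "inj_on d {..<k}"
  proof (rule inj_onI, rule ccontr)
    fix i j
    assume "i \<in> {..<k}" "j \<in> {..<k}" "d i = d j" "i \<noteq> j"
    then show False
      using d[of i] d[of j] disj unfolding disjoint_family_on_def by auto
  qed
  ultimately have "is_cycle W R (map d [0..<k])"
    using dS S(1) \<open>k > 0\<close>
    by (auto simp: is_cycle_iff_clique[OF pre] distinct_map atLeast0LessThan)
  then show ?thesis
    by (metis diff_zero length_map length_upt)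
qed

theorem theorem8p2:
  fixes W :: "'a set" and R :: "'a rel" and n :: nat
  assumes "preorder_on W R" and "n \<ge> 1"
  shows "(hereditarily_irresolvable (n + 1) (alexandroff_topology W R) \<longleftrightarrow>
            circumference W R \<le> enat n \<and> (\<nexists>x. strictly_ascending_chain W R x)) \<and>
         (finite W \<longrightarrow>
           (hereditarily_irresolvable (n + 1) (alexandroff_topology W R) \<longleftrightarrow>
              circumference W R \<le> enat n))"
proof -
  let ?X = "alexandroff_topology W R"
  have irres: "\<not> resolvable (n + 1) (subtopology ?X S)"
    if "hereditarily_irresolvable (n + 1) ?X" "S \<subseteq> W" "S \<noteq> {}" for S
    using that by (simp add: hereditarily_irresolvable_def topspace_alexandroff_topology)
  \<comment> \<open>A cycle with more than \<open>n\<close> points would be a non-empty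
    \<open>(n + 1)\<close>-resolvable subspace.\<close>
  have "length xs \<le> n" if "hereditarily_irresolvable (n + 1) ?X" "is_cycle W R xs" for xs
    using irres[OF that(1), of "set xs"] resolvable_cycle[OF assms(1) that(2), of "n + 1"] that(2)
    by (force simp: is_cycle_def)
  moreover have "\<not> strictly_ascending_chain W R x"
    if "hereditarily_irresolvable (n + 1) ?X" for x
    using irres[OF that, of "range x"] resolvable_strictly_ascending_chain[OF assms(1), of x "n + 1"]
    by (auto simp: strictly_ascending_chain_def)
  moreover have "hereditarily_irresolvable (n + 1) ?X"
    if circ: "circumference W R \<le> enat n" and no_chain: "\<nexists>x. strictly_ascending_chain W R x"
    unfolding hereditarily_irresolvable_def topspace_alexandroff_topology
  proof (intro allI impI notI)
    fix S
    assume "S \<subseteq> W \<and> S \<noteq> {}" and "resolvable (n + 1) (subtopology ?X S)"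
    then obtain xs where "is_cycle W R xs" and "length xs = n + 1"
      using ex_cycle_if_resolvable[OF assms(1) no_chain] by (metis add_gr_0 zero_less_one)
    then show False
      using circ by (auto simp: circumference_le_iff)
  qed
  ultimately have main: "hereditarily_irresolvable (n + 1) ?X \<longleftrightarrow>
      circumference W R \<le> enat n \<and> (\<nexists>x. strictly_ascending_chain W R x)"
    unfolding circumference_le_iff by blast
  \<comment> \<open>A chain is injective, so its range is infinite; for finite \<open>W\<close> the
    second statement thus follows from the first.\<close>
  have "\<not> strictly_ascending_chain W R x" if "finite W" for x
  proof
    assume chain: "strictly_ascending_chain W R x"
    then have "range x \<subseteq> W"
      by (auto simp: strictly_ascending_chain_def)
    then have "finite (range x)"
      using that by (rule finite_subset)
    then show False
      using inj_strictly_ascending_chain[OF assms(1) chain] finite_imageD by blast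
  qed
  with main show ?thesis
    by blast
qed

end
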